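(* Let $p,q,r\geq 2$ and let $X$ be a based space. For all $f\in\Omega^p(X)$, $g\in \Omega^q(X)$, $h\in \Omega^r(X)$, the map \[(-1)^{pr}[[ f,g],h]+ (-1)^{pq}[[ g,h] ,f]+(-1)^{rq}[[ h,f],g]\in \Omega^{p+q+r-2}(X)\] is null-homotopic by an image-relative homotopy, i.e. it is image-relative homotopic to the constant map.
   Context: All spaces are Hausdorff and maps are continuous and based. $\Omega^m(X)=\Omega^m(X,x_0)$ is the set of maps $(I^m,\partial I^m)\to (X,x_0)$, $I=[0,1]$, identified with based maps $S^m\to X$ via a fixed homeomorphism $I^m/\partial I^m\cong S^m$; finite sums are concatenations in the first coordinate, $-f(t_1,\dots,t_m)=f(1-t_1,t_2,\dots,t_m)$, and $(-1)^e f$ means $f$ or $-f$ according to the parity of $e$. $a_{p,q}:S^{p+q-1}\to S^p\vee S^q$ is the standard (surjective) attaching map of the $(p+q)$-cell of $S^p\times S^q$, i.e. the restriction of the product characteristic map $D^p\times D^q\to S^p\times S^q$ to the boundary, with the usual orientation conventions, for which the classical graded Jacobi identity $(-1)^{pr}[[a,b],c]+(-1)^{pq}[[b,c],a]+(-1)^{rq}[[c,a],b]=0$ holds on homotopy classes $a\in\pi_p$, $b\in\pi_q$, $c\in\pi_r$ (this may be taken as known). For $f\in\Omega^p(X)$, $g\in\Omega^q(X)$, $[f,g]=(f\vee g)\circ a_{p,q}\in\Omega^{p+q-1}(X)$. Based maps $f,g:Y\to X$ are image-relative homotopic if there is a based homotopy $H:Y\times I\to X$ from $f$ to $g$ with $\operatorname{Im}(H)=\operatorname{Im}(f)\cup\operatorname{Im}(g)$.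 *)

theory Defs
  imports "HOL-Analysis.Analysis"
begin

text \<open>
  Points of \<open>I\<^sup>m\<close> are sequences of reals supported on the coordinates \<open>0, \<dots>, m - 1\<close>, as in the
  library's \<open>Euclidean_space\<close> and \<open>nsphere\<close>; the coordinate \<open>t\<^sub>1\<close> of the literature is coordinate \<open>0\<close>.
\<close>

definition cube :: "nat \<Rightarrow> (nat \<Rightarrow> real) topology" where
  "cube m = subtopology (Euclidean_space m) {x. \<forall>i<m. 0 \<le> x i \<and> x i \<le> 1}"

definition cube_bd :: "nat \<Rightarrow> (nat \<Rightarrow> real) set" where
  "cube_bd m = {x \<in> topspace (cube m). \<exists>i<m. x i = 0 \<or> x i = 1}"

text \<open>
  \<open>\<Omega>\<^sup>m(X, x\<^sub>0)\<close>. Only the values on the cube are relevant; a representing function is unconstrained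
  elsewhere.
\<close>

definition loops :: "nat \<Rightarrow> 'a topology \<Rightarrow> 'a \<Rightarrow> ((nat \<Rightarrow> real) \<Rightarrow> 'a) set" where
  "loops m X x0 = {f. continuous_map (cube m) X f \<and> (\<forall>x \<in> cube_bd m. f x = x0)}"

definition loop_add :: "((nat \<Rightarrow> real) \<Rightarrow> 'a) \<Rightarrow> ((nat \<Rightarrow> real) \<Rightarrow> 'a) \<Rightarrow> (nat \<Rightarrow> real) \<Rightarrow> 'a" where
  "loop_add f g = (\<lambda>t. if t 0 \<le> 1/2 then f (t(0 := 2 * t 0)) else g (t(0 := 2 * t 0 - 1)))"

definition loop_neg :: "((nat \<Rightarrow> real) \<Rightarrow> 'a) \<Rightarrow> (nat \<Rightarrow> real) \<Rightarrow> 'a" where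
  "loop_neg f = (\<lambda>t. f (t(0 := 1 - t 0)))"

definition loop_sign :: "nat \<Rightarrow> ((nat \<Rightarrow> real) \<Rightarrow> 'a) \<Rightarrow> (nat \<Rightarrow> real) \<Rightarrow> 'a" where
  "loop_sign e f = (if even e then f else loop_neg f)"

text \<open>
  The fixed identifications behind the phrase ``a map out of a sphere''. The map \<open>\<kappa> m\<close> is the
  composite \<open>I\<^sup>m \<rightarrow> I\<^sup>m/\<partial>I\<^sup>m \<cong> S\<^sup>m\<close>: a quotient map whose only nontrivial fibre is \<open>\<partial>I\<^sup>m\<close>; it is also
  the characteristic map \<open>D\<^sup>m \<rightarrow> S\<^sup>m\<close> of the top cell, with \<open>I\<^sup>m\<close> serving as \<open>D\<^sup>m\<close>. The map \<open>\<beta> p q\<close> is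
  the homeomorphism of \<open>S\<^bsup>p+q-1\<^esup>\<close> with the boundary \<open>\<partial>I\<^sup>p \<times> I\<^sup>q \<union> I\<^sup>p \<times> \<partial>I\<^sup>q\<close> of the product cell; it
  sends the base point into \<open>\<partial>I\<^sup>p \<times> \<partial>I\<^sup>q\<close>, so that the attaching map is based. Orientations are not
  fixed here, see \<open>graded_Jacobi_convention\<close> below.
\<close>

definition sphere_base :: "(nat \<Rightarrow> (nat \<Rightarrow> real) \<Rightarrow> (nat \<Rightarrow> real)) \<Rightarrow> nat \<Rightarrow> (nat \<Rightarrow> real)" where
  "sphere_base \<kappa> m = \<kappa> m (\<lambda>_. 0)"

definition product_cell_bd :: "nat \<Rightarrow> nat \<Rightarrow> ((nat \<Rightarrow> real) \<times> (nat \<Rightarrow> real)) topology" where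
  "product_cell_bd p q =
     subtopology (prod_topology (cube p) (cube q))
       (cube_bd p \<times> topspace (cube q) \<union> topspace (cube p) \<times> cube_bd q)"

definition sphere_identifications ::
  "(nat \<Rightarrow> (nat \<Rightarrow> real) \<Rightarrow> (nat \<Rightarrow> real)) \<Rightarrow>
   (nat \<Rightarrow> nat \<Rightarrow> (nat \<Rightarrow> real) \<Rightarrow> (nat \<Rightarrow> real) \<times> (nat \<Rightarrow> real)) \<Rightarrow> bool" where
  "sphere_identifications \<kappa> \<beta> \<longleftrightarrow>
     (\<forall>m\<ge>1. quotient_map (cube m) (nsphere m) (\<kappa> m) \<and>
        (\<forall>x \<in> topspace (cube m). \<forall>y \<in> topspace (cube m).
           \<kappa> m x = \<kappa> m y \<longleftrightarrow> x = y \<or> (x \<in> cube_bd m \<and> y \<in> cube_bd m))) \<and>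
     (\<forall>p\<ge>1. \<forall>q\<ge>1.
        homeomorphic_map (nsphere (p + q - 1)) (product_cell_bd p q) (\<beta> p q) \<and>
        \<beta> p q (sphere_base \<kappa> (p + q - 1)) \<in> cube_bd p \<times> cube_bd q)"

text \<open>
  The based map \<open>S\<^sup>m \<rightarrow> X\<close> corresponding to an element of \<open>\<Omega>\<^sup>m(X)\<close>. The choice of preimage made by
  \<open>inv_into\<close> is irrelevant, as elements of \<open>\<Omega>\<^sup>m(X)\<close> are constant on \<open>\<partial>I\<^sup>m\<close>.
\<close>

definition sphere_map ::
  "(nat \<Rightarrow> (nat \<Rightarrow> real) \<Rightarrow> (nat \<Rightarrow> real)) \<Rightarrow> nat \<Rightarrow> ((nat \<Rightarrow> real) \<Rightarrow> 'a) \<Rightarrow> (nat \<Rightarrow> real) \<Rightarrow> 'a" where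
  "sphere_map \<kappa> m f = (\<lambda>s. f (inv_into (topspace (cube m)) (\<kappa> m) s))"

text \<open>
  \<open>a\<^bsub>p,q\<^esub>\<close>: the product characteristic map \<open>\<kappa> p \<times> \<kappa> q\<close> restricted to the boundary. The wedge
  \<open>S\<^sup>p \<or> S\<^sup>q\<close> is the subspace of \<open>S\<^sup>p \<times> S\<^sup>q\<close> of pairs with a component at the base point.
\<close>

definition attaching_map ::
  "(nat \<Rightarrow> (nat \<Rightarrow> real) \<Rightarrow> (nat \<Rightarrow> real)) \<Rightarrow>
   (nat \<Rightarrow> nat \<Rightarrow> (nat \<Rightarrow> real) \<Rightarrow> (nat \<Rightarrow> real) \<times> (nat \<Rightarrow> real)) \<Rightarrow>
   nat \<Rightarrow> nat \<Rightarrow> (nat \<Rightarrow> real) \<Rightarrow> (nat \<Rightarrow> real) \<times> (nat \<Rightarrow> real)" where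
  "attaching_map \<kappa> \<beta> p q = map_prod (\<kappa> p) (\<kappa> q) \<circ> \<beta> p q"

definition wedge_map :: "'b \<Rightarrow> ('c \<Rightarrow> 'a) \<Rightarrow> ('b \<Rightarrow> 'a) \<Rightarrow> 'c \<times> 'b \<Rightarrow> 'a" where
  "wedge_map b u v = (\<lambda>(s, t). if t = b then u s else v t)"

definition whitehead ::
  "(nat \<Rightarrow> (nat \<Rightarrow> real) \<Rightarrow> (nat \<Rightarrow> real)) \<Rightarrow>
   (nat \<Rightarrow> nat \<Rightarrow> (nat \<Rightarrow> real) \<Rightarrow> (nat \<Rightarrow> real) \<times> (nat \<Rightarrow> real)) \<Rightarrow>
   nat \<Rightarrow> nat \<Rightarrow> ((nat \<Rightarrow> real) \<Rightarrow> 'a) \<Rightarrow> ((nat \<Rightarrow> real) \<Rightarrow> 'a) \<Rightarrow> (nat \<Rightarrow> real) \<Rightarrow> 'a" where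
  "whitehead \<kappa> \<beta> p q f g =
     wedge_map (sphere_base \<kappa> q) (sphere_map \<kappa> p f) (sphere_map \<kappa> q g)
       \<circ> attaching_map \<kappa> \<beta> p q \<circ> \<kappa> (p + q - 1)"

definition jacobi_sum ::
  "(nat \<Rightarrow> (nat \<Rightarrow> real) \<Rightarrow> (nat \<Rightarrow> real)) \<Rightarrow>
   (nat \<Rightarrow> nat \<Rightarrow> (nat \<Rightarrow> real) \<Rightarrow> (nat \<Rightarrow> real) \<times> (nat \<Rightarrow> real)) \<Rightarrow>
   nat \<Rightarrow> nat \<Rightarrow> nat \<Rightarrow>
   ((nat \<Rightarrow> real) \<Rightarrow> 'a) \<Rightarrow> ((nat \<Rightarrow> real) \<Rightarrow> 'a) \<Rightarrow> ((nat \<Rightarrow> real) \<Rightarrow> 'a) \<Rightarrow> (nat \<Rightarrow> real) \<Rightarrow> 'a" where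
  "jacobi_sum \<kappa> \<beta> p q r f g h =
     loop_add
       (loop_add
         (loop_sign (p * r) (whitehead \<kappa> \<beta> (p + q - 1) r (whitehead \<kappa> \<beta> p q f g) h))
         (loop_sign (p * q) (whitehead \<kappa> \<beta> (q + r - 1) p (whitehead \<kappa> \<beta> q r g h) f)))
       (loop_sign (r * q) (whitehead \<kappa> \<beta> (r + p - 1) q (whitehead \<kappa> \<beta> r p h f) g))"

text \<open>
  The orientation convention on \<open>\<kappa>\<close> and \<open>\<beta>\<close>: they are such that the classical graded Jacobi identity
  holds in homotopy groups, i.e. the Jacobi sum is null-homotopic by an ordinary based homotopy, with
  no control on its image. (An orientation-preserving choice, with \<open>\<partial>(I\<^sup>p \<times> I\<^sup>q)\<close> oriented by the outward
  normal first, has this property; changing some of the orientations can destroy it.)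

  HOL cannot quantify over all types inside a formula, so the identity is required for Hausdorff
  spaces carried by the one type \<open>nat \<Rightarrow> real\<close> only. This demands less of \<open>\<kappa>\<close> and \<open>\<beta>\<close> than the
  identity over all spaces. It includes, up to homeomorphism, every Hausdorff space with at most
  continuum many points, hence the universal example \<open>S\<^sup>p \<or> S\<^sup>q \<or> S\<^sup>r\<close>.
\<close>

definition graded_Jacobi_convention ::
  "(nat \<Rightarrow> (nat \<Rightarrow> real) \<Rightarrow> (nat \<Rightarrow> real)) \<Rightarrow>
   (nat \<Rightarrow> nat \<Rightarrow> (nat \<Rightarrow> real) \<Rightarrow> (nat \<Rightarrow> real) \<times> (nat \<Rightarrow> real)) \<Rightarrow> bool" where
  "graded_Jacobi_convention \<kappa> \<beta> \<longleftrightarrow>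
     (\<forall>p q r. \<forall>(Z :: (nat \<Rightarrow> real) topology) z0 a b c.
        p \<ge> 2 \<longrightarrow> q \<ge> 2 \<longrightarrow> r \<ge> 2 \<longrightarrow> Hausdorff_space Z \<longrightarrow> z0 \<in> topspace Z \<longrightarrow>
        a \<in> loops p Z z0 \<longrightarrow> b \<in> loops q Z z0 \<longrightarrow> c \<in> loops r Z z0 \<longrightarrow>
        homotopic_with (\<lambda>u. u (sphere_base \<kappa> (p + q + r - 2)) = z0) (nsphere (p + q + r - 2)) Z
          (sphere_map \<kappa> (p + q + r - 2) (jacobi_sum \<kappa> \<beta> p q r a b c)) (\<lambda>_. z0))"

definition image_relative_homotopic ::
  "'b topology \<Rightarrow> 'b \<Rightarrow> 'a topology \<Rightarrow> 'a \<Rightarrow> ('b \<Rightarrow> 'a) \<Rightarrow> ('b \<Rightarrow> 'a) \<Rightarrow> bool" where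
  "image_relative_homotopic Y y0 X x0 f g \<longleftrightarrow>
     (\<exists>H. continuous_map (prod_topology Y (top_of_set {0..1::real})) X H \<and>
          (\<forall>y \<in> topspace Y. H (y, 0) = f y \<and> H (y, 1) = g y) \<and>
          (\<forall>t \<in> {0..1}. H (y0, t) = x0) \<and>
          H ` (topspace Y \<times> {0..1}) = f ` topspace Y \<union> g ` topspace Y)"

end

theory Submission
  imports Defs
begin

text \<open>
  The triple \<open>(f, g, h)\<close> factors as \<open>\<phi> \<circ> (a, b, c)\<close> through the universal example
  \<open>Z = S\<^sup>p \<or> S\<^sup>q \<or> S\<^sup>r\<close>, where \<open>a\<close>, \<open>b\<close>, \<open>c\<close> are the inclusions of the three spheres. A null homotopy
  of the Jacobi sum of \<open>a\<close>, \<open>b\<close>, \<open>c\<close>, composed with \<open>\<phi>\<close>, is a null homotopy of the Jacobi sum of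
  \<open>f\<close>, \<open>g\<close>, \<open>h\<close> with values in \<open>\<phi> ` Z = im f \<union> im g \<union> im h\<close>. Since attaching maps are surjective, the
  image of a Whitehead product is the union of the images of its factors, so the Jacobi sum itself
  already has this image.
\<close>

subsection \<open>Cubes\<close>

lemma topspace_cube: "topspace (cube m) = {x. (\<forall>i<m. 0 \<le> x i \<and> x i \<le> 1) \<and> (\<forall>i\<ge>m. x i = 0)}"
  by (auto simp: cube_def topspace_Euclidean_space)

lemma cube_bd_subset: "cube_bd m \<subseteq> topspace (cube m)"
  by (auto simp: cube_bd_def)

lemma zero_in_cube_bd: "m \<ge> 1 \<Longrightarrow> (\<lambda>_. 0) \<in> cube_bd m"
  by (auto simp: cube_bd_def topspace_cube intro!: exI [of _ 0])

text \<open>The cube is a product over all indices, with factor [0,1] below \<open>m\<close> and the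
  single point 0 from \<open>m\<close> on, so Tychonoff applies. Compactness later makes the legs of
  the wedge closed and the maps onto them quotient maps.\<close>

lemma compact_space_cube: "compact_space (cube m)"
proof -
  have mem: "x \<in> (if i < m then {0..1} else {0}) \<longleftrightarrow> (i < m \<longrightarrow> 0 \<le> x \<and> x \<le> 1) \<and> (m \<le> i \<longrightarrow> x = 0)"
    for x :: real and i
    by auto
  have "cube m = subtopology (powertop_real UNIV) (\<Pi>\<^sub>E i\<in>UNIV. if i < m then {0..1} else {0})"
    unfolding cube_def Euclidean_space_def subtopology_subtopology
    by (intro arg_cong [of _ _ "subtopology _"]) (auto simp: PiE_UNIV_domain Pi_iff mem)
  moreover have "compactin (powertop_real UNIV) (\<Pi>\<^sub>E i\<in>UNIV. if i < m then {0..1} else {0})"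
    by (auto simp: compactin_PiE)
  ultimately show ?thesis
    by (simp add: compact_space_subtopology)
qed

lemma continuous_map_cube_projection: "continuous_map (cube m) euclideanreal (\<lambda>x. x i)"
  unfolding cube_def Euclidean_space_def
  by (intro continuous_map_from_subtopology continuous_map_product_projection) auto

lemma cube_update: "\<lbrakk>m \<ge> 1; t \<in> topspace (cube m); 0 \<le> s; s \<le> 1\<rbrakk> \<Longrightarrow> t(0 := s) \<in> topspace (cube m)"
  by (auto simp: topspace_cube)

text \<open>A boundary coordinate other than \<open>0\<close> survives the update. Only if
  coordinate \<open>0\<close> itself is extremal must the new value be extremal too, as is the case
  for \<open>2 * t 0\<close> on the lower half, \<open>2 * t 0 - 1\<close> on the upper half, and
  \<open>1 - t 0\<close>.\<close>

lemma cube_bd_update: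
  assumes "m \<ge> 1" "x \<in> cube_bd m" "0 \<le> s" "s \<le> 1" and s: "x 0 \<in> {0, 1} \<Longrightarrow> s \<in> {0, 1}"
  shows "x(0 := s) \<in> cube_bd m"
proof -
  obtain i where i: "i < m" "x i = 0 \<or> x i = 1" and x: "x \<in> topspace (cube m)"
    using assms(2) by (auto simp: cube_bd_def)
  have "(x(0 := s)) i = 0 \<or> (x(0 := s)) i = 1"
    using i(2) s by (cases "i = 0") auto
  moreover have "x(0 := s) \<in> topspace (cube m)"
    using cube_update [OF assms(1) x assms(3,4)] .
  ultimately show ?thesis
    using i(1) unfolding cube_bd_def by blast
qed

lemma cube_coord0: "\<lbrakk>m \<ge> 1; x \<in> topspace (cube m)\<rbrakk> \<Longrightarrow> 0 \<le> x 0 \<and> x 0 \<le> 1"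
  by (simp add: topspace_cube)

text \<open>The set \<open>S\<close> allows for half cubes, since \<open>2 * t 0\<close> and
  \<open>2 * t 0 - 1\<close> stay in [0,1] only on the corresponding half.\<close>

lemma continuous_map_cube_update:
  assumes "m \<ge> 1" and "continuous_map (subtopology (cube m) S) euclideanreal s"
    and "\<And>t. \<lbrakk>t \<in> topspace (cube m); t \<in> S\<rbrakk> \<Longrightarrow> 0 \<le> s t \<and> s t \<le> 1"
  shows "continuous_map (subtopology (cube m) S) (cube m) (\<lambda>t. t(0 := s t))"
proof -
  have "continuous_map (subtopology (cube m) S) (powertop_real UNIV) (\<lambda>t. t(0 := s t))"
    unfolding continuous_map_componentwise_UNIV
  proof
    fix i :: nat
    show "continuous_map (subtopology (cube m) S) euclideanreal (\<lambda>t. (t(0 := s t)) i)"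
      using assms(2)
      by (cases "i = 0")
        (simp_all add: continuous_map_from_subtopology continuous_map_cube_projection)
  qed
  moreover have "t(0 := s t) \<in> topspace (cube m)" if "t \<in> topspace (cube m)" "t \<in> S" for t
    using cube_update [OF assms(1) that(1)] assms(3) [OF that] by blast
  ultimately show ?thesis
    unfolding cube_def Euclidean_space_def continuous_map_in_subtopology subtopology_subtopology
    by (auto simp: Pi_iff image_subset_iff topspace_Euclidean_space)
qed

subsection \<open>Concatenation\<close>

lemma loops_bd: "\<lbrakk>f \<in> loops m X x0; x \<in> cube_bd m\<rbrakk> \<Longrightarrow> f x = x0"
  by (simp add: loops_def)

lemma loops_continuous: "f \<in> loops m X x0 \<Longrightarrow> continuous_map (cube m) X f"
  by (simp add: loops_def)

lemma loop_add_in_loops: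
  assumes m: "m \<ge> 1" and f: "f \<in> loops m X x0" and g: "g \<in> loops m X x0"
  shows "loop_add f g \<in> loops m X x0"
proof -
  have "continuous_map (cube m) X
      (\<lambda>t. if t 0 \<le> 1/2 then (f \<circ> (\<lambda>t. t(0 := 2 * t 0))) t else (g \<circ> (\<lambda>t. t(0 := 2 * t 0 - 1))) t)"
  proof (rule continuous_map_cases_le)
    show "continuous_map (cube m) euclideanreal (\<lambda>t. t 0)"
      by (rule continuous_map_cube_projection)
    show "continuous_map (subtopology (cube m) {t \<in> topspace (cube m). t 0 \<le> 1/2}) X
        (f \<circ> (\<lambda>t. t(0 := 2 * t 0)))"
    proof (rule continuous_map_compose [OF continuous_map_cube_update [OF m] loops_continuous [OF f]])
      show "continuous_map (subtopology (cube m) {t \<in> topspace (cube m). t 0 \<le> 1/2}) euclideanreal (\<lambda>t. 2 * t 0)"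
        by (intro continuous_intros continuous_map_from_subtopology continuous_map_cube_projection)
    qed (use m in \<open>auto simp: topspace_cube\<close>)
    show "continuous_map (subtopology (cube m) {t \<in> topspace (cube m). 1/2 \<le> t 0}) X
        (g \<circ> (\<lambda>t. t(0 := 2 * t 0 - 1)))"
    proof (rule continuous_map_compose [OF continuous_map_cube_update [OF m] loops_continuous [OF g]])
      show "continuous_map (subtopology (cube m) {t \<in> topspace (cube m). 1/2 \<le> t 0}) euclideanreal (\<lambda>t. 2 * t 0 - 1)"
        by (intro continuous_intros continuous_map_from_subtopology continuous_map_cube_projection)
    qed (use m in \<open>auto simp: topspace_cube\<close>)
    \<comment> \<open>On the dividing face the first coordinate becomes 1 for \<open>f\<close> and 0
      for \<open>g\<close>; both points lie on the boundary, so both values are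
      \<open>x0\<close>.\<close>
    show "(f \<circ> (\<lambda>t. t(0 := 2 * t 0))) t = (g \<circ> (\<lambda>t. t(0 := 2 * t 0 - 1))) t"
      if "t \<in> topspace (cube m)" "t 0 = 1/2" for t
    proof -
      have "t(0 := 1) \<in> cube_bd m" "t(0 := 0) \<in> cube_bd m"
        using m that by (auto simp: cube_bd_def topspace_cube)
      then show ?thesis
        unfolding o_def that(2) by (simp add: loops_bd [OF f] loops_bd [OF g])
    qed
  qed auto
  moreover have "loop_add f g x = x0" if x: "x \<in> cube_bd m" for x
  proof -
    have x01: "0 \<le> x 0" "x 0 \<le> 1"
      using cube_coord0 [OF m] x cube_bd_subset by blast+
    show ?thesis
    proof (cases "x 0 \<le> 1/2")
      case True
      then have "x(0 := 2 * x 0) \<in> cube_bd m"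
        using x01 by (intro cube_bd_update m x) auto
      with True show ?thesis
        by (simp add: loop_add_def loops_bd [OF f])
    next
      case False
      then have "x(0 := 2 * x 0 - 1) \<in> cube_bd m"
        using x01 by (intro cube_bd_update m x) auto
      with False show ?thesis
        by (simp add: loop_add_def loops_bd [OF g])
    qed
  qed
  ultimately show ?thesis
    unfolding loops_def loop_add_def o_def by blast
qed

lemma loop_add_image:
  assumes m: "m \<ge> 1"
  assumes f: "f \<in> loops m X x0" and g: "g \<in> loops m X x0"
  shows "loop_add f g ` topspace (cube m) = f ` topspace (cube m) \<union> g ` topspace (cube m)"
proof
  show "loop_add f g ` topspace (cube m) \<subseteq> f ` topspace (cube m) \<union> g ` topspace (cube m)"
  proof clarify
    fix x
    assume x: "x \<in> topspace (cube m)" "loop_add f g x \<notin> g ` topspace (cube m)"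
    have x01: "0 \<le> x 0" "x 0 \<le> 1"
      using cube_coord0 [OF m x(1)] by simp_all
    have "x 0 \<le> 1/2"
      using x x01 cube_update [OF m x(1), of "2 * x 0 - 1"] by (force simp: loop_add_def)
    then show "loop_add f g x \<in> f ` topspace (cube m)"
      using x01 cube_update [OF m x(1), of "2 * x 0"] by (simp add: loop_add_def)
  qed
  show "f ` topspace (cube m) \<union> g ` topspace (cube m) \<subseteq> loop_add f g ` topspace (cube m)"
  proof (intro Un_least image_subsetI)
    fix x
    assume x: "x \<in> topspace (cube m)"
    have x01: "0 \<le> x 0" "x 0 \<le> 1"
      using cube_coord0 [OF m x] by simp_all
    have "f x = loop_add f g (x(0 := x 0 / 2))"
      using x01 by (simp add: loop_add_def)
    then show "f x \<in> loop_add f g ` topspace (cube m)"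
      using cube_update [OF m x, of "x 0 / 2"] x01 by auto
    show "g x \<in> loop_add f g ` topspace (cube m)"
    proof (cases "x 0 = 0")
      \<comment> \<open>The candidate preimage has first coordinate 1/2 and so falls into the half
        used by \<open>f\<close>. But \<open>x\<close> is a boundary point, and the sum takes the
        value \<open>g x = x0\<close> at \<open>x\<close> itself.\<close>
      case True
      then have "x \<in> cube_bd m"
        using x m by (auto simp: cube_bd_def intro!: exI [of _ 0])
      then have "loop_add f g x = g x"
        by (simp add: loops_bd [OF loop_add_in_loops [OF m f g]] loops_bd [OF g])
      with x show ?thesis
        by (metis imageI)
    next
      case False
      then have "g x = loop_add f g (x(0 := (x 0 + 1) / 2))"
        using x01 by (simp add: loop_add_def field_simps)
      then show ?thesis
        using cube_update [OF m x, of "(x 0 + 1) / 2"] x01 by auto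
    qed
  qed
qed

lemma loop_sign_in_loops:
  assumes m: "m \<ge> 1" and f: "f \<in> loops m X x0"
  shows "loop_sign e f \<in> loops m X x0"
proof -
  have "continuous_map (subtopology (cube m) (topspace (cube m))) X (f \<circ> (\<lambda>t. t(0 := 1 - t 0)))"
  proof (rule continuous_map_compose [OF continuous_map_cube_update [OF m] loops_continuous [OF f]])
    show "continuous_map (subtopology (cube m) (topspace (cube m))) euclideanreal (\<lambda>t. 1 - t 0)"
      by (intro continuous_intros continuous_map_from_subtopology continuous_map_cube_projection)
  qed (use m in \<open>auto simp: topspace_cube\<close>)
  moreover have "x(0 := 1 - x 0) \<in> cube_bd m" if "x \<in> cube_bd m" for x
    using cube_coord0 [OF m] that cube_bd_subset by (intro cube_bd_update [OF m that]) force+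
  ultimately have "loop_neg f \<in> loops m X x0"
    using f by (simp add: loops_def loop_neg_def o_def)
  with f show ?thesis
    by (simp add: loop_sign_def)
qed

text \<open>Reflecting the first coordinate is an involution of the cube, hence onto.\<close>

lemma loop_sign_image:
  assumes m: "m \<ge> 1"
  shows "loop_sign e f ` topspace (cube m) = f ` topspace (cube m)"
proof -
  let ?r = "\<lambda>t :: nat \<Rightarrow> real. t(0 := 1 - t 0)"
  have r: "?r x \<in> topspace (cube m)" "?r (?r x) = x" if "x \<in> topspace (cube m)" for x
    using that m by (auto simp: topspace_cube)
  have "?r ` topspace (cube m) = topspace (cube m)"
    using r by (metis (no_types, lifting) image_subsetI imageI subsetI subset_antisym)
  moreover have "loop_neg f ` topspace (cube m) = f ` (?r ` topspace (cube m))"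
    by (simp add: loop_neg_def image_image)
  ultimately show ?thesis
    by (simp add: loop_sign_def)
qed

text \<open>Naturality for an arbitrary function \<open>\<phi>\<close>: concatenation only
  reparametrises. The hypotheses are confined to the cube because loops are unconstrained elsewhere;
  the reparametrised point stays in it.\<close>

lemma loop_add_cong:
  assumes "m \<ge> 1" and "t \<in> topspace (cube m)"
    and "\<And>x. x \<in> topspace (cube m) \<Longrightarrow> f x = \<phi> (f' x)"
    and "\<And>x. x \<in> topspace (cube m) \<Longrightarrow> g x = \<phi> (g' x)"
  shows "loop_add f g t = \<phi> (loop_add f' g' t)"
proof -
  have "0 \<le> t 0" "t 0 \<le> 1"
    using cube_coord0 [OF assms(1,2)] by simp_all
  then show ?thesis
    using assms(3,4) cube_update [OF assms(1,2)] by (simp add: loop_add_def)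
qed

lemma loop_sign_cong:
  assumes "m \<ge> 1" and "t \<in> topspace (cube m)"
    and "\<And>x. x \<in> topspace (cube m) \<Longrightarrow> f x = \<phi> (f' x)"
  shows "loop_sign e f t = \<phi> (loop_sign e f' t)"
proof -
  have "0 \<le> t 0" "t 0 \<le> 1"
    using cube_coord0 [OF assms(1,2)] by simp_all
  then show ?thesis
    using assms(2,3) cube_update [OF assms(1,2)] by (simp add: loop_sign_def loop_neg_def)
qed

subsection \<open>Whitehead products\<close>

context
  fixes \<kappa> :: "nat \<Rightarrow> (nat \<Rightarrow> real) \<Rightarrow> (nat \<Rightarrow> real)"
    and \<beta> :: "nat \<Rightarrow> nat \<Rightarrow> (nat \<Rightarrow> real) \<Rightarrow> (nat \<Rightarrow> real) \<times> (nat \<Rightarrow> real)"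
  assumes ident: "sphere_identifications \<kappa> \<beta>"
begin

lemma kappa_quotient: "m \<ge> 1 \<Longrightarrow> quotient_map (cube m) (nsphere m) (\<kappa> m)"
  using ident by (simp add: sphere_identifications_def)

lemma kappa_image: "m \<ge> 1 \<Longrightarrow> \<kappa> m ` topspace (cube m) = topspace (nsphere m)"
  using kappa_quotient quotient_imp_surjective_map by blast

lemma kappa_eq_iff:
  "\<lbrakk>m \<ge> 1; x \<in> topspace (cube m); y \<in> topspace (cube m)\<rbrakk>
    \<Longrightarrow> \<kappa> m x = \<kappa> m y \<longleftrightarrow> x = y \<or> (x \<in> cube_bd m \<and> y \<in> cube_bd m)"
  using ident by (simp add: sphere_identifications_def)

text \<open>This turns the base point test in \<open>wedge_map\<close> into membership in the
  boundary of the cube.\<close>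

lemma kappa_eq_base_iff:
  "\<lbrakk>m \<ge> 1; x \<in> topspace (cube m)\<rbrakk> \<Longrightarrow> \<kappa> m x = sphere_base \<kappa> m \<longleftrightarrow> x \<in> cube_bd m"
  using kappa_eq_iff [of m x "\<lambda>_. 0"] zero_in_cube_bd [of m] cube_bd_subset [of m]
  by (auto simp: sphere_base_def)

lemma sphere_base_in_nsphere: "m \<ge> 1 \<Longrightarrow> sphere_base \<kappa> m \<in> topspace (nsphere m)"
  using kappa_image [of m] zero_in_cube_bd [of m] cube_bd_subset [of m]
  by (auto simp: sphere_base_def)

lemma inv_kappa:
  assumes "m \<ge> 1" "s \<in> topspace (nsphere m)"
  shows "inv_into (topspace (cube m)) (\<kappa> m) s \<in> topspace (cube m)"
    and "\<kappa> m (inv_into (topspace (cube m)) (\<kappa> m) s) = s"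
  using assms kappa_image [of m] by (auto simp: inv_into_into f_inv_into_f)

lemma beta_homeo:
  "\<lbrakk>p \<ge> 1; q \<ge> 1\<rbrakk> \<Longrightarrow> homeomorphic_map (nsphere (p + q - 1)) (product_cell_bd p q) (\<beta> p q)"
  using ident by (simp add: sphere_identifications_def)

lemma beta_base:
  "\<lbrakk>p \<ge> 1; q \<ge> 1\<rbrakk> \<Longrightarrow> \<beta> p q (sphere_base \<kappa> (p + q - 1)) \<in> cube_bd p \<times> cube_bd q"
  using ident by (simp add: sphere_identifications_def)

lemma topspace_product_cell_bd:
  "topspace (product_cell_bd p q) = cube_bd p \<times> topspace (cube q) \<union> topspace (cube p) \<times> cube_bd q"
  using cube_bd_subset [of p] cube_bd_subset [of q] by (auto simp: product_cell_bd_def)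

text \<open>The preimage picked by \<open>inv_into\<close> can differ from \<open>x\<close> only if
  both lie on the boundary, where \<open>f\<close> is constant.\<close>

lemma sphere_map_kappa:
  assumes "m \<ge> 1" "f \<in> loops m X x0" "x \<in> topspace (cube m)"
  shows "sphere_map \<kappa> m f (\<kappa> m x) = f x"
proof -
  let ?y = "inv_into (topspace (cube m)) (\<kappa> m) (\<kappa> m x)"
  have "?y \<in> topspace (cube m)" "\<kappa> m ?y = \<kappa> m x"
    using assms by (auto simp: inv_into_into f_inv_into_f)
  then have "?y = x \<or> ?y \<in> cube_bd m \<and> x \<in> cube_bd m"
    using kappa_eq_iff assms by blast
  then show ?thesis
    using loops_bd [OF assms(2)] unfolding sphere_map_def by auto
qed

lemma sphere_map_image:
  assumes "m \<ge> 1" "f \<in> loops m X x0"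
  shows "sphere_map \<kappa> m f ` topspace (nsphere m) = f ` topspace (cube m)"
  using sphere_map_kappa [OF assms] by (simp flip: kappa_image [OF assms(1)] add: image_image)

text \<open>The second component is the base point exactly when \<open>v\<close> is on the boundary,
  which decides the branch of \<open>wedge_map\<close>. The formula replaces spheres by cubes when
  the image and the continuity of the product are determined.\<close>

lemma whitehead_eq:
  assumes pq: "p \<ge> 1" "q \<ge> 1" and fg: "f \<in> loops p X x0" "g \<in> loops q X x0"
    and y: "\<beta> p q (\<kappa> (p + q - 1) y) = (u, v)" "(u, v) \<in> topspace (product_cell_bd p q)"
  shows "whitehead \<kappa> \<beta> p q f g y = (if v \<in> cube_bd q then f u else g v)"
proof -
  have uv: "u \<in> topspace (cube p)" "v \<in> topspace (cube q)"
    using y(2) cube_bd_subset by (auto simp: topspace_product_cell_bd)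
  then show ?thesis
    using y(1) pq fg
    by (simp add: whitehead_def attaching_map_def wedge_map_def kappa_eq_base_iff sphere_map_kappa)
qed

lemma beta_kappa_in:
  assumes "p \<ge> 1" "q \<ge> 1" "y \<in> topspace (cube (p + q - 1))"
  shows "\<beta> p q (\<kappa> (p + q - 1) y) \<in> topspace (product_cell_bd p q)"
proof -
  have "p + q - 1 \<ge> 1"
    using assms(1,2) by linarith
  then have "\<kappa> (p + q - 1) y \<in> topspace (nsphere (p + q - 1))"
    using kappa_image assms(3) by blast
  then show ?thesis
    using homeomorphic_imp_surjective_map [OF beta_homeo [OF assms(1,2)]] by blast
qed

lemma beta_kappa_onto:
  assumes "p \<ge> 1" "q \<ge> 1" "w \<in> topspace (product_cell_bd p q)"
  obtains y where "y \<in> topspace (cube (p + q - 1))" "\<beta> p q (\<kappa> (p + q - 1) y) = w"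
proof -
  have n: "p + q - 1 \<ge> 1"
    using assms(1,2) by linarith
  have "w \<in> \<beta> p q ` topspace (nsphere (p + q - 1))"
    unfolding homeomorphic_imp_surjective_map [OF beta_homeo [OF assms(1,2)]] by (rule assms(3))
  then obtain s where s: "s \<in> topspace (nsphere (p + q - 1))" "\<beta> p q s = w"
    by blast
  show ?thesis
    by (rule that [OF inv_kappa(1) [OF n s(1)]]) (simp only: inv_kappa(2) [OF n s(1)] s(2))
qed

text \<open>The inclusion from right to left is the surjectivity of the attaching map: the pairs
  \<open>(u, \<lambda>_. 0)\<close> and \<open>(\<lambda>_. 0, v)\<close> lie on the boundary of the
  product cell, are hit by the parametrisation, and yield \<open>f u\<close> and
  \<open>g v\<close>.\<close>

lemma whitehead_image:
  assumes pq: "p \<ge> 1" "q \<ge> 1" and fg: "f \<in> loops p X x0" "g \<in> loops q X x0"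
  shows "whitehead \<kappa> \<beta> p q f g ` topspace (cube (p + q - 1))
    = f ` topspace (cube p) \<union> g ` topspace (cube q)"
proof
  show "whitehead \<kappa> \<beta> p q f g ` topspace (cube (p + q - 1))
    \<subseteq> f ` topspace (cube p) \<union> g ` topspace (cube q)"
  proof (rule image_subsetI)
    fix y
    assume "y \<in> topspace (cube (p + q - 1))"
    moreover obtain u v where uv: "\<beta> p q (\<kappa> (p + q - 1) y) = (u, v)"
      by fastforce
    ultimately have "(u, v) \<in> topspace (product_cell_bd p q)"
      using beta_kappa_in [OF pq] by metis
    moreover from this have "u \<in> topspace (cube p)" "v \<in> topspace (cube q)"
      using cube_bd_subset by (auto simp: topspace_product_cell_bd)
    ultimately show "whitehead \<kappa> \<beta> p q f g y \<in> f ` topspace (cube p) \<union> g ` topspace (cube q)"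
      using whitehead_eq [OF pq fg uv] by auto
  qed
  show "f ` topspace (cube p) \<union> g ` topspace (cube q)
    \<subseteq> whitehead \<kappa> \<beta> p q f g ` topspace (cube (p + q - 1))"
  proof (intro Un_least image_subsetI)
    fix u
    assume "u \<in> topspace (cube p)"
    then have w: "(u, \<lambda>_. 0) \<in> topspace (product_cell_bd p q)"
      using zero_in_cube_bd [OF pq(2)] by (simp add: topspace_product_cell_bd)
    then obtain y where y: "y \<in> topspace (cube (p + q - 1))" "\<beta> p q (\<kappa> (p + q - 1) y) = (u, \<lambda>_. 0)"
      using beta_kappa_onto [OF pq] by metis
    then have "whitehead \<kappa> \<beta> p q f g y = f u"
      using whitehead_eq [OF pq fg y(2) w] zero_in_cube_bd [OF pq(2)] by simp
    with y show "f u \<in> whitehead \<kappa> \<beta> p q f g ` topspace (cube (p + q - 1))"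
      by (metis imageI)
  next
    fix v
    assume "v \<in> topspace (cube q)"
    then have w: "(\<lambda>_. 0, v) \<in> topspace (product_cell_bd p q)"
      using zero_in_cube_bd [OF pq(1)] by (simp add: topspace_product_cell_bd)
    then obtain y where y: "y \<in> topspace (cube (p + q - 1))" "\<beta> p q (\<kappa> (p + q - 1) y) = (\<lambda>_. 0, v)"
      using beta_kappa_onto [OF pq] by metis
    \<comment> \<open>If \<open>v\<close> is itself on the boundary, the formula returns
      \<open>f (\<lambda>_. 0)\<close> rather than \<open>g v\<close>; both equal
      \<open>x0\<close>.\<close>
    then have "whitehead \<kappa> \<beta> p q f g y = g v"
      using whitehead_eq [OF pq fg y(2) w] zero_in_cube_bd [OF pq(1)] loops_bd fg by metis
    with y show "g v \<in> whitehead \<kappa> \<beta> p q f g ` topspace (cube (p + q - 1))"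
      by (metis imageI)
  qed
qed

text \<open>A point of the Hausdorff sphere is closed, and the boundary is the preimage of the base
  point under the continuous map \<open>\<kappa> m\<close>.\<close>

lemma closedin_cube_bd: "m \<ge> 1 \<Longrightarrow> closedin (cube m) (cube_bd m)"
proof -
  assume m: "m \<ge> 1"
  have "closedin (nsphere m) {sphere_base \<kappa> m}"
    using sphere_base_in_nsphere [OF m]
    by (intro closedin_Hausdorff_singleton)
      (auto simp: nsphere Hausdorff_space_subtopology Hausdorff_space_product_topology)
  then have "closedin (cube m) {x \<in> topspace (cube m). \<kappa> m x \<in> {sphere_base \<kappa> m}}"
    using closedin_continuous_map_preimage quotient_imp_continuous_map [OF kappa_quotient [OF m]]
    by blast
  moreover have "{x \<in> topspace (cube m). \<kappa> m x \<in> {sphere_base \<kappa> m}} = cube_bd m"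
    using kappa_eq_base_iff [OF m] cube_bd_subset [of m] by auto
  ultimately show ?thesis
    by simp
qed

lemma whitehead_in_loops:
  assumes pq: "p \<ge> 1" "q \<ge> 1" and fg: "f \<in> loops p X x0" "g \<in> loops q X x0"
  shows "whitehead \<kappa> \<beta> p q f g \<in> loops (p + q - 1) X x0"
proof -
  let ?n = "p + q - 1"
  let ?P = "product_cell_bd p q"
  have n: "?n \<ge> 1"
    using pq by linarith
  \<comment> \<open>\<open>w\<close> is the product read on the boundary of the product cell, where
    continuity can be checked on two closed faces.\<close>
  define w where "w = (\<lambda>(u, v). if v \<in> cube_bd q then f u else g v)"
  have fstc: "continuous_map ?P (cube p) fst" and sndc: "continuous_map ?P (cube q) snd"
    unfolding product_cell_bd_def
    by (simp_all add: continuous_map_from_subtopology continuous_map_fst continuous_map_snd)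
  \<comment> \<open>The Boolean index selects the face on which \<open>f \<circ> fst\<close> or
    \<open>g \<circ> snd\<close> is used. On the overlap both components are boundary points, so
    both maps give \<open>x0\<close>.\<close>
  have w_cont: "continuous_map ?P X w"
  proof (rule pasting_lemma_closed [where I = "{True, False}"
        and T = "\<lambda>b. if b then {x \<in> topspace ?P. snd x \<in> cube_bd q}
                      else {x \<in> topspace ?P. fst x \<in> cube_bd p}"
        and f = "\<lambda>b. if b then f \<circ> fst else g \<circ> snd"])
    show "closedin ?P (if b then {x \<in> topspace ?P. snd x \<in> cube_bd q}
                      else {x \<in> topspace ?P. fst x \<in> cube_bd p})" for b
      using closedin_continuous_map_preimage [OF fstc closedin_cube_bd [OF pq(1)]]
        closedin_continuous_map_preimage [OF sndc closedin_cube_bd [OF pq(2)]]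
      by (cases b) simp_all
    have "continuous_map ?P X (f \<circ> fst)" "continuous_map ?P X (g \<circ> snd)"
      using continuous_map_compose fstc sndc loops_continuous fg by metis+
    then show "continuous_map (subtopology ?P (if b then {x \<in> topspace ?P. snd x \<in> cube_bd q}
                      else {x \<in> topspace ?P. fst x \<in> cube_bd p})) X (if b then f \<circ> fst else g \<circ> snd)" for b
      by (cases b) (simp_all only: if_True if_False continuous_map_from_subtopology)
    show "(if i then f \<circ> fst else g \<circ> snd) x = (if j then f \<circ> fst else g \<circ> snd) x"
      if "x \<in> topspace ?P \<inter> (if i then {x \<in> topspace ?P. snd x \<in> cube_bd q}
                      else {x \<in> topspace ?P. fst x \<in> cube_bd p})
        \<inter> (if j then {x \<in> topspace ?P. snd x \<in> cube_bd q}
                      else {x \<in> topspace ?P. fst x \<in> cube_bd p})" for i j x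
      using that loops_bd [OF fg(1)] loops_bd [OF fg(2)] by (cases i; cases j) auto
    show "\<exists>b. b \<in> {True, False} \<and>
        x \<in> (if b then {x \<in> topspace ?P. snd x \<in> cube_bd q}
             else {x \<in> topspace ?P. fst x \<in> cube_bd p}) \<and>
        w x = (if b then f \<circ> fst else g \<circ> snd) x" if "x \<in> topspace ?P" for x
    proof (intro exI conjI)
      show "x \<in> (if snd x \<in> cube_bd q then {x \<in> topspace ?P. snd x \<in> cube_bd q}
             else {x \<in> topspace ?P. fst x \<in> cube_bd p})"
        using that by (cases x) (auto simp: topspace_product_cell_bd)
    qed (simp_all add: w_def split_beta)
  qed auto
  have eq: "whitehead \<kappa> \<beta> p q f g y = (w \<circ> (\<beta> p q \<circ> \<kappa> ?n)) y" if "y \<in> topspace (cube ?n)" for y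
  proof -
    obtain u v where uv: "\<beta> p q (\<kappa> ?n y) = (u, v)"
      by fastforce
    then have "(u, v) \<in> topspace ?P"
      using beta_kappa_in [OF pq that] by simp
    with uv whitehead_eq [OF pq fg uv] show ?thesis
      by (simp add: w_def)
  qed
  have "continuous_map (cube ?n) X (w \<circ> (\<beta> p q \<circ> \<kappa> ?n))"
    using continuous_map_compose w_cont homeomorphic_imp_continuous_map [OF beta_homeo [OF pq]]
      quotient_imp_continuous_map [OF kappa_quotient [OF n]] by metis
  then have "continuous_map (cube ?n) X (whitehead \<kappa> \<beta> p q f g)"
    using eq by (metis (no_types, lifting) continuous_map_eq)
  \<comment> \<open>The boundary collapses to the base point of the sphere, which
    \<open>\<beta>\<close> sends to a pair of boundary points; there \<open>w\<close> is a value of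
    \<open>f\<close> on the boundary.\<close>
  moreover have "whitehead \<kappa> \<beta> p q f g y = x0" if y: "y \<in> cube_bd ?n" for y
  proof -
    have "y \<in> topspace (cube ?n)"
      using y cube_bd_subset by blast
    moreover from this have "\<kappa> ?n y = sphere_base \<kappa> ?n"
      using y kappa_eq_base_iff [OF n] by blast
    then have "\<beta> p q (\<kappa> ?n y) \<in> cube_bd p \<times> cube_bd q"
      using beta_base [OF pq] by simp
    ultimately show ?thesis
      using eq by (auto simp: w_def loops_bd [OF fg(1)])
  qed
  ultimately show ?thesis
    by (simp add: loops_def)
qed

text \<open>The preimages chosen by \<open>inv_into\<close> depend on \<open>\<kappa>\<close> alone,
  so both products evaluate their factors at the same points of the cubes. Naturality is thus a
  pointwise equality, not one up to homotopy.\<close>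

lemma whitehead_cong:
  assumes pq: "p \<ge> 1" "q \<ge> 1" and y: "y \<in> topspace (cube (p + q - 1))"
    and f: "\<And>x. x \<in> topspace (cube p) \<Longrightarrow> f x = \<phi> (f' x)"
    and g: "\<And>x. x \<in> topspace (cube q) \<Longrightarrow> g x = \<phi> (g' x)"
  shows "whitehead \<kappa> \<beta> p q f g y = \<phi> (whitehead \<kappa> \<beta> p q f' g' y)"
proof -
  obtain u v where uv: "\<beta> p q (\<kappa> (p + q - 1) y) = (u, v)"
    by fastforce
  then have "(u, v) \<in> topspace (product_cell_bd p q)"
    using beta_kappa_in [OF pq y] by metis
  then have "u \<in> topspace (cube p)" "v \<in> topspace (cube q)"
    using cube_bd_subset by (auto simp: topspace_product_cell_bd)
  then have "\<kappa> p u \<in> topspace (nsphere p)" "\<kappa> q v \<in> topspace (nsphere q)"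
    using kappa_image pq by blast+
  then show ?thesis
    using uv f g inv_kappa(1) pq
    by (simp add: whitehead_def attaching_map_def wedge_map_def sphere_map_def)
qed

subsection \<open>The Jacobi sum\<close>

text \<open>The dimension is a separate variable \<open>n\<close> so that the lemma applies to all
  three cyclic orders, whose dimensions are equal but not syntactically so.\<close>

lemma whitehead_whitehead:
  assumes pqr: "p \<ge> 1" "q \<ge> 1" "r \<ge> 1"
    and fgh: "f \<in> loops p X x0" "g \<in> loops q X x0" "h \<in> loops r X x0"
    and n: "n = p + q + r - 2"
  shows "loop_sign e (whitehead \<kappa> \<beta> (p + q - 1) r (whitehead \<kappa> \<beta> p q f g) h) \<in> loops n X x0"
    and "loop_sign e (whitehead \<kappa> \<beta> (p + q - 1) r (whitehead \<kappa> \<beta> p q f g) h) ` topspace (cube n)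
      = f ` topspace (cube p) \<union> g ` topspace (cube q) \<union> h ` topspace (cube r)"
proof -
  have n': "n = p + q - 1 + r - 1" "n \<ge> 1" and m: "p + q - 1 \<ge> 1"
    using pqr n by linarith+
  show "loop_sign e (whitehead \<kappa> \<beta> (p + q - 1) r (whitehead \<kappa> \<beta> p q f g) h) \<in> loops n X x0"
    using whitehead_in_loops [OF m pqr(3) whitehead_in_loops [OF pqr(1,2) fgh(1,2)] fgh(3)]
    unfolding n'(1) [symmetric] by (rule loop_sign_in_loops [OF n'(2)])
  show "loop_sign e (whitehead \<kappa> \<beta> (p + q - 1) r (whitehead \<kappa> \<beta> p q f g) h) ` topspace (cube n)
      = f ` topspace (cube p) \<union> g ` topspace (cube q) \<union> h ` topspace (cube r)"
    using whitehead_image [OF m pqr(3) whitehead_in_loops [OF pqr(1,2) fgh(1,2)] fgh(3)]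
    unfolding n'(1) [symmetric] loop_sign_image [OF n'(2)] whitehead_image [OF pqr(1,2) fgh(1,2)] .
qed

lemma whitehead_whitehead_cong:
  assumes pqr: "p \<ge> 1" "q \<ge> 1" "r \<ge> 1" and y: "y \<in> topspace (cube n)"
    and n: "n = p + q + r - 2"
    and f: "\<And>x. x \<in> topspace (cube p) \<Longrightarrow> f x = \<phi> (f' x)"
    and g: "\<And>x. x \<in> topspace (cube q) \<Longrightarrow> g x = \<phi> (g' x)"
    and h: "\<And>x. x \<in> topspace (cube r) \<Longrightarrow> h x = \<phi> (h' x)"
  shows "loop_sign e (whitehead \<kappa> \<beta> (p + q - 1) r (whitehead \<kappa> \<beta> p q f g) h) y
    = \<phi> (loop_sign e (whitehead \<kappa> \<beta> (p + q - 1) r (whitehead \<kappa> \<beta> p q f' g') h') y)"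
proof -
  have n': "n = p + q - 1 + r - 1" "n \<ge> 1" and m: "p + q - 1 \<ge> 1"
    using pqr n by linarith+
  show ?thesis
  proof (rule loop_sign_cong [OF n'(2) y])
    fix x
    assume "x \<in> topspace (cube n)"
    then have x: "x \<in> topspace (cube (p + q - 1 + r - 1))"
      unfolding n'(1) .
    show "whitehead \<kappa> \<beta> (p + q - 1) r (whitehead \<kappa> \<beta> p q f g) h x
      = \<phi> (whitehead \<kappa> \<beta> (p + q - 1) r (whitehead \<kappa> \<beta> p q f' g') h' x)"
      by (rule whitehead_cong [OF m pqr(3) x], rule whitehead_cong [OF pqr(1,2)]) (simp_all add: f g h)
  qed
qed

text \<open>Each summand already has the union of the three images as its image, whatever its sign
  or cyclic order, and concatenation adds nothing to it.\<close>

lemma jacobi_sum_in_loops_and_image: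
  assumes pqr: "p \<ge> 1" "q \<ge> 1" "r \<ge> 1"
    and fgh: "f \<in> loops p X x0" "g \<in> loops q X x0" "h \<in> loops r X x0"
  shows "jacobi_sum \<kappa> \<beta> p q r f g h \<in> loops (p + q + r - 2) X x0"
    and "jacobi_sum \<kappa> \<beta> p q r f g h ` topspace (cube (p + q + r - 2))
      = f ` topspace (cube p) \<union> g ` topspace (cube q) \<union> h ` topspace (cube r)"
proof -
  let ?n = "p + q + r - 2"
  have n: "?n \<ge> 1"
    using pqr by linarith
  note A = whitehead_whitehead [OF pqr fgh refl, of "p * r"]
  have B1: "?n = q + r + p - 2" and C1: "?n = r + p + q - 2"
    by simp_all
  note B = whitehead_whitehead [OF pqr(2,3,1) fgh(2,3,1) B1, of "p * q"]
  note C = whitehead_whitehead [OF pqr(3,1,2) fgh(3,1,2) C1, of "r * q"]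
  note AB = loop_add_in_loops [OF n A(1) B(1)]
  show "jacobi_sum \<kappa> \<beta> p q r f g h \<in> loops ?n X x0"
    unfolding jacobi_sum_def by (rule loop_add_in_loops [OF n AB C(1)])
  show "jacobi_sum \<kappa> \<beta> p q r f g h ` topspace (cube ?n)
      = f ` topspace (cube p) \<union> g ` topspace (cube q) \<union> h ` topspace (cube r)"
    unfolding jacobi_sum_def loop_add_image [OF n AB C(1)] loop_add_image [OF n A(1) B(1)]
      A(2) B(2) C(2)
    by blast
qed

text \<open>Exact naturality in the target, by which a null homotopy in the universal example can be
  pushed forward along \<open>\<phi>\<close>.\<close>

lemma jacobi_sum_cong:
  assumes pqr: "p \<ge> 1" "q \<ge> 1" "r \<ge> 1" and y: "y \<in> topspace (cube (p + q + r - 2))"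
    and fgh: "\<And>x. x \<in> topspace (cube p) \<Longrightarrow> f x = \<phi> (f' x)"
      "\<And>x. x \<in> topspace (cube q) \<Longrightarrow> g x = \<phi> (g' x)"
      "\<And>x. x \<in> topspace (cube r) \<Longrightarrow> h x = \<phi> (h' x)"
  shows "jacobi_sum \<kappa> \<beta> p q r f g h y = \<phi> (jacobi_sum \<kappa> \<beta> p q r f' g' h' y)"
proof -
  have n: "p + q + r - 2 \<ge> 1"
    using pqr by linarith
  show ?thesis
    unfolding jacobi_sum_def
  proof (rule loop_add_cong [OF n y], rule loop_add_cong [OF n], assumption, goal_cases)
    case (1 x z)
    then show ?case
      by (intro whitehead_whitehead_cong pqr fgh) simp_all
  next
    case (2 x z)
    then show ?case
      by (intro whitehead_whitehead_cong pqr fgh) (simp_all add: ac_simps)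
  next
    case (3 x)
    then show ?case
      by (intro whitehead_whitehead_cong pqr fgh) (simp_all add: ac_simps)
  qed
qed

subsection \<open>The universal example\<close>

text \<open>
  The wedge of the spheres \<open>S\<^bsup>m k\<^esup>\<close>, \<open>k < N\<close>, is realised in \<open>nat \<Rightarrow> real\<close> by translating every base
  point to the origin and putting the sphere number \<open>k\<close> into the coordinates congruent to \<open>k\<close>
  modulo \<open>N\<close>.
\<close>

definition wedge_leg :: "nat \<Rightarrow> nat \<Rightarrow> nat \<Rightarrow> (nat \<Rightarrow> real) \<Rightarrow> nat \<Rightarrow> real" where
  "wedge_leg N k m x =
     (\<lambda>i. if i mod N = k then \<kappa> m x (i div N) - sphere_base \<kappa> m (i div N) else 0)"

lemma continuous_map_wedge_leg:
  assumes "m \<ge> 1"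
  shows "continuous_map (cube m) (powertop_real UNIV) (wedge_leg N k m)"
  unfolding continuous_map_componentwise_UNIV
proof
  fix i
  have "continuous_map (cube m) euclideanreal ((\<lambda>s. s (i div N)) \<circ> \<kappa> m)"
    using quotient_imp_continuous_map [OF kappa_quotient [OF assms]]
      continuous_map_nsphere_projection continuous_map_compose by blast
  then show "continuous_map (cube m) euclideanreal (\<lambda>x. wedge_leg N k m x i)"
    by (cases "i mod N = k") (auto simp: wedge_leg_def o_def intro!: continuous_intros)
qed

lemma wedge_leg_eq:
  assumes k: "k < N" and eq: "wedge_leg N k m x = wedge_leg N k m y"
  shows "\<kappa> m x = \<kappa> m y"
proof
  fix j
  \<comment> \<open>The slot \<open>j * N + k\<close> has remainder \<open>k\<close> and quotient
    \<open>j\<close>, so it stores coordinate \<open>j\<close> of the sphere; the translation by the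
    base point cancels.\<close>
  show "\<kappa> m x j = \<kappa> m y j"
    using fun_cong [OF eq, of "j * N + k"] k by (simp add: wedge_leg_def)
qed

lemma wedge_leg_eq_zero:
  assumes "k < N" "m \<ge> 1" "x \<in> topspace (cube m)"
  shows "wedge_leg N k m x = (\<lambda>_. 0) \<longleftrightarrow> x \<in> cube_bd m"
proof -
  have "wedge_leg N k m (\<lambda>_. 0) = (\<lambda>_. 0)"
    by (auto simp: wedge_leg_def sphere_base_def)
  then have "wedge_leg N k m x = (\<lambda>_. 0) \<longleftrightarrow> \<kappa> m x = sphere_base \<kappa> m"
    using wedge_leg_eq [OF assms(1), of m x "\<lambda>_. 0"]
    by (auto simp: sphere_base_def wedge_leg_def)
  then show ?thesis
    using kappa_eq_base_iff assms by blast
qed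

text \<open>An index has only one remainder modulo \<open>N\<close>, so in each coordinate at least
  one of the two legs vanishes. Distinct legs therefore meet only at the origin.\<close>

lemma wedge_leg_disjoint:
  assumes "wedge_leg N k m x = wedge_leg N l n y" "k \<noteq> l"
  shows "wedge_leg N k m x = (\<lambda>_. 0)"
proof
  fix i
  show "wedge_leg N k m x i = 0"
    using fun_cong [OF assms(1), of i] assms(2) by (auto simp: wedge_leg_def split: if_splits)
qed

text \<open>The carrier of \<open>Z\<close> is \<open>nat \<Rightarrow> real\<close>, the type on
  which \<open>graded_Jacobi_convention\<close> provides the Jacobi identity. The map
  \<open>\<phi>\<close> is built leg by leg from the universal property of quotients, then
  glued.\<close>

lemma universal_example:
  fixes m :: "nat \<Rightarrow> nat" and F :: "nat \<Rightarrow> (nat \<Rightarrow> real) \<Rightarrow> 'a"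
  assumes m: "\<And>k. k < N \<Longrightarrow> m k \<ge> 1" and F: "\<And>k. k < N \<Longrightarrow> F k \<in> loops (m k) X x0"
    and "N > 0"
  obtains Z :: "(nat \<Rightarrow> real) topology" and z0 a \<phi>
  where "Hausdorff_space Z" "z0 \<in> topspace Z" "\<And>k. k < N \<Longrightarrow> a k \<in> loops (m k) Z z0"
    "continuous_map Z X \<phi>" "\<phi> z0 = x0"
    "topspace Z = (\<Union>k<N. a k ` topspace (cube (m k)))"
    "\<And>k x. \<lbrakk>k < N; x \<in> topspace (cube (m k))\<rbrakk> \<Longrightarrow> F k x = \<phi> (a k x)"
proof -
  define a where "a k = wedge_leg N k (m k)" for k
  define T where "T k = a k ` topspace (cube (m k))" for k
  define Z where "Z = subtopology (powertop_real UNIV) (\<Union>k<N. T k)"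
  have topZ: "topspace Z = (\<Union>k<N. T k)"
    by (simp add: Z_def)
  have Haus: "Hausdorff_space Z"
    by (simp add: Z_def Hausdorff_space_subtopology Hausdorff_space_product_topology)
  have a_cont: "continuous_map (cube (m k)) Z (a k)" if "k < N" for k
    using that continuous_map_wedge_leg [OF m [OF that]]
    by (auto simp: Z_def a_def T_def continuous_map_in_subtopology)
  have a_zero: "a k x = (\<lambda>_. 0) \<longleftrightarrow> x \<in> cube_bd (m k)" if "k < N" "x \<in> topspace (cube (m k))" for k x
    unfolding a_def using that m wedge_leg_eq_zero by blast
  have a_loop: "a k \<in> loops (m k) Z (\<lambda>_. 0)" if "k < N" for k
  proof -
    have "a k x = (\<lambda>_. 0)" if "x \<in> cube_bd (m k)" for x
      using a_zero [OF \<open>k < N\<close>] that cube_bd_subset [of "m k"] by blast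
    then show ?thesis
      using a_cont [OF that] by (simp add: loops_def)
  qed
  \<comment> \<open>Well-definedness of \<open>\<phi>\<close>: points identified in the wedge are
    equal points of one cube or boundary points, and all boundary values are
    \<open>x0\<close>.\<close>
  have F_eq: "F k x = F l y"
    if "k < N" "l < N" "x \<in> topspace (cube (m k))" "y \<in> topspace (cube (m l))" "a k x = a l y" for k l x y
  proof (cases "k = l")
    case True
    then have "\<kappa> (m k) x = \<kappa> (m k) y"
      using wedge_leg_eq [OF that(1)] that(5) unfolding a_def by blast
    then have "x = y \<or> x \<in> cube_bd (m k) \<and> y \<in> cube_bd (m k)"
      using kappa_eq_iff [OF m [OF that(1)] that(3)] that(4) True by blast
    then show ?thesis
      using loops_bd [OF F [OF that(1)]] True by auto
  next
    case False
    then have "a k x = (\<lambda>_. 0)"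
      using that(5) wedge_leg_disjoint unfolding a_def by blast
    then have "x \<in> cube_bd (m k)" "y \<in> cube_bd (m l)"
      using a_zero [OF that(1,3)] a_zero [OF that(2,4)] that(5) by simp_all
    then show ?thesis
      by (simp add: loops_bd [OF F [OF that(1)]] loops_bd [OF F [OF that(2)]])
  qed
  \<comment> \<open>A leg is a compact image in a Hausdorff space.\<close>
  have T_closed: "closedin Z (T k)" if "k < N" for k
    unfolding T_def using compact_space_cube [unfolded compact_space_def] a_cont [OF that]
    by (intro compactin_imp_closedin [OF Haus] image_compactin)
  have T_sub: "T k \<subseteq> topspace Z" if "k < N" for k
    using that topZ by blast
  have "\<exists>\<psi>. continuous_map (subtopology Z (T k)) X \<psi> \<and> (\<forall>x\<in>topspace (cube (m k)). \<psi> (a k x) = F k x)"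
    if k: "k < N" for k
  proof -
    \<comment> \<open>A continuous surjection from a compact space onto a Hausdorff space is a
      quotient map, so \<open>F k\<close>, constant on its fibres by \<open>F_eq\<close>, descends
      to the leg.\<close>
    have quot: "quotient_map (cube (m k)) (subtopology Z (T k)) (a k)"
    proof (rule continuous_imp_quotient_map)
      show "continuous_map (cube (m k)) (subtopology Z (T k)) (a k)"
        using a_cont [OF k] by (auto simp: continuous_map_in_subtopology T_def)
      show "a k ` topspace (cube (m k)) = topspace (subtopology Z (T k))"
        using T_sub [OF k] by (auto simp: T_def)
    qed (auto simp: compact_space_cube Haus Hausdorff_space_subtopology)
    show ?thesis
    proof (rule quotient_map_lift_exists [OF quot loops_continuous [OF F [OF k]] F_eq [OF k k]])
      fix \<psi>
      assume "continuous_map (subtopology Z (T k)) X \<psi>"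
        and "\<And>x. x \<in> topspace (cube (m k)) \<Longrightarrow> \<psi> (a k x) = F k x"
      then show ?thesis
        by (intro exI [of _ \<psi>]) simp
    qed
  qed
  then have "\<forall>k. \<exists>\<psi>. k < N \<longrightarrow> continuous_map (subtopology Z (T k)) X \<psi> \<and>
      (\<forall>x\<in>topspace (cube (m k)). \<psi> (a k x) = F k x)"
    by blast
  from choice [OF this] obtain \<psi>
    where \<psi>: "\<And>k. k < N \<Longrightarrow> continuous_map (subtopology Z (T k)) X (\<psi> k)"
      "\<And>k x. \<lbrakk>k < N; x \<in> topspace (cube (m k))\<rbrakk> \<Longrightarrow> \<psi> k (a k x) = F k x"
    by blast
  \<comment> \<open>The legs form a finite closed cover of \<open>Z\<close>, and \<open>F_eq\<close>
    gives agreement on their intersections.\<close>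
  obtain \<phi> where \<phi>: "continuous_map Z X \<phi>"
    "\<And>x k. \<lbrakk>k \<in> {..<N}; x \<in> topspace Z \<inter> T k\<rbrakk> \<Longrightarrow> \<phi> x = \<psi> k x"
  proof (rule pasting_lemma_exists_closed [OF finite_lessThan, of Z T N X \<psi>])
    note obt = that
    show "topspace Z \<subseteq> \<Union> (T ` {..<N})"
      by (simp add: topZ)
    show "\<psi> k x = \<psi> l x" if kl: "k \<in> {..<N}" "l \<in> {..<N}" "x \<in> topspace Z \<inter> T k \<inter> T l" for k l x
    proof -
      obtain u v where "u \<in> topspace (cube (m k))" "x = a k u" "v \<in> topspace (cube (m l))" "x = a l v"
        using kl(3) unfolding T_def by blast
      then show ?thesis
        using \<psi>(2) [of k u] \<psi>(2) [of l v] F_eq [of k l u v] kl(1,2) by simp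
    qed
    show thesis if "continuous_map Z X \<phi>"
      "\<And>x k. \<lbrakk>k \<in> {..<N}; x \<in> topspace Z \<inter> T k\<rbrakk> \<Longrightarrow> \<phi> x = \<psi> k x" for \<phi>
      by (rule obt [OF that])
  qed (use T_closed \<psi>(1) in \<open>simp_all only: lessThan_iff\<close>)
  have F\<phi>: "F k x = \<phi> (a k x)" if "k < N" "x \<in> topspace (cube (m k))" for k x
  proof -
    have "a k x \<in> topspace Z \<inter> T k"
      using that T_sub [of k] unfolding T_def by blast
    then show ?thesis
      using \<phi>(2) [of k "a k x"] \<psi>(2) [OF that] that(1) by simp
  qed
  \<comment> \<open>Leg \<open>0\<close> exists because \<open>N > 0\<close>; it shows that the
    origin belongs to \<open>Z\<close> and is sent to \<open>x0\<close>.\<close>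
  have "a 0 (\<lambda>_. 0) = (\<lambda>_. 0)" "(\<lambda>_. 0) \<in> topspace (cube (m 0))" "F 0 (\<lambda>_. 0) = x0"
    using a_zero [of 0 "\<lambda>_. 0"] zero_in_cube_bd [OF m] cube_bd_subset loops_bd [OF F] \<open>N > 0\<close>
    by blast+
  then have \<phi>0: "\<phi> (\<lambda>_. 0) = x0"
    using F\<phi> [of 0 "\<lambda>_. 0"] \<open>N > 0\<close> by simp
  have base: "(\<lambda>_. 0) \<in> topspace Z"
    using continuous_map_image_subset_topspace [OF a_cont [OF \<open>N > 0\<close>]]
      \<open>a 0 (\<lambda>_. 0) = (\<lambda>_. 0)\<close> \<open>(\<lambda>_. 0) \<in> topspace (cube (m 0))\<close>
    by (metis image_subset_iff)
  show ?thesis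
    by (rule that [OF Haus base a_loop \<phi>(1) \<phi>0 topZ [unfolded T_def] F\<phi>])
qed

end

section \<open>Pushing the null homotopy forward from the universal example\<close>

theorem proposition3p13:
  fixes \<kappa> :: "nat \<Rightarrow> (nat \<Rightarrow> real) \<Rightarrow> (nat \<Rightarrow> real)"
    and \<beta> :: "nat \<Rightarrow> nat \<Rightarrow> (nat \<Rightarrow> real) \<Rightarrow> (nat \<Rightarrow> real) \<times> (nat \<Rightarrow> real)"
    and X :: "'a topology" and x0 :: 'a
    and p q r :: nat
    and f g h :: "(nat \<Rightarrow> real) \<Rightarrow> 'a"
  assumes "sphere_identifications \<kappa> \<beta>"
    and "graded_Jacobi_convention \<kappa> \<beta>"
    and "p \<ge> 2" and "q \<ge> 2" and "r \<ge> 2"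
    and "Hausdorff_space X" and "x0 \<in> topspace X"
    and "f \<in> loops p X x0" and "g \<in> loops q X x0" and "h \<in> loops r X x0"
  shows "jacobi_sum \<kappa> \<beta> p q r f g h \<in> loops (p + q + r - 2) X x0 \<and>
    image_relative_homotopic (nsphere (p + q + r - 2)) (sphere_base \<kappa> (p + q + r - 2)) X x0
      (sphere_map \<kappa> (p + q + r - 2) (jacobi_sum \<kappa> \<beta> p q r f g h)) (\<lambda>_. x0)"
proof
  let ?n = "p + q + r - 2"
  let ?S = "nsphere ?n"
  let ?J = "sphere_map \<kappa> ?n (jacobi_sum \<kappa> \<beta> p q r f g h)"
  note ident = assms(1)
  have pqr: "p \<ge> 1" "q \<ge> 1" "r \<ge> 1" and n: "?n \<ge> 1"
    using assms(3-5) by linarith+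
  note J = jacobi_sum_in_loops_and_image [OF ident pqr assms(8-10)]
  show "jacobi_sum \<kappa> \<beta> p q r f g h \<in> loops ?n X x0"
    by (rule J(1))
  define m where "m k = [p, q, r] ! k" for k
  define F where "F k = [f, g, h] ! k" for k
  have "F k \<in> loops (m k) X x0 \<and> m k \<ge> 1" if less: "k < 3" for k
  proof -
    consider "k = 0" | "k = 1" | "k = 2"
      using less by linarith
    then show ?thesis
      by cases (use pqr assms(8-10) in \<open>simp_all add: m_def F_def\<close>)
  qed
  then have F: "\<And>k. k < 3 \<Longrightarrow> m k \<ge> 1" "\<And>k. k < 3 \<Longrightarrow> F k \<in> loops (m k) X x0"
    by blast+
  obtain Z :: "(nat \<Rightarrow> real) topology" and z0 a \<phi>
    where Z: "Hausdorff_space Z" "z0 \<in> topspace Z" "\<And>k. k < 3 \<Longrightarrow> a k \<in> loops (m k) Z z0"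
      and \<phi>: "continuous_map Z X \<phi>" "\<phi> z0 = x0"
      and topZ: "topspace Z = (\<Union>k<3. a k ` topspace (cube (m k)))"
      and F\<phi>: "\<And>k x. \<lbrakk>k < 3; x \<in> topspace (cube (m k))\<rbrakk> \<Longrightarrow> F k x = \<phi> (a k x)"
  proof (rule universal_example [OF ident, of 3 m F X x0])
    show "m k \<ge> 1" "F k \<in> loops (m k) X x0" if "k < 3" for k
      using F that by blast+
    show "(0 :: nat) < 3"
      by simp
  qed (rule that; simp only:)
  have fgh: "\<And>x. x \<in> topspace (cube p) \<Longrightarrow> f x = \<phi> (a 0 x)"
      "\<And>x. x \<in> topspace (cube q) \<Longrightarrow> g x = \<phi> (a 1 x)"
      "\<And>x. x \<in> topspace (cube r) \<Longrightarrow> h x = \<phi> (a 2 x)"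
    using F\<phi> [of 0] F\<phi> [of 1] F\<phi> [of 2] by (simp_all add: m_def F_def)
  have "homotopic_with (\<lambda>u. u (sphere_base \<kappa> ?n) = z0) ?S Z
      (sphere_map \<kappa> ?n (jacobi_sum \<kappa> \<beta> p q r (a 0) (a 1) (a 2))) (\<lambda>_. z0)"
    using assms(2-5) Z(1,2) Z(3) [of 0] Z(3) [of 1] Z(3) [of 2]
    unfolding graded_Jacobi_convention_def by (simp add: m_def)
  then obtain k where k: "continuous_map (prod_topology (top_of_set {0..1::real}) ?S) Z k"
    "\<And>y. k (0, y) = sphere_map \<kappa> ?n (jacobi_sum \<kappa> \<beta> p q r (a 0) (a 1) (a 2)) y"
    "\<And>y. k (1, y) = z0" "\<And>t. t \<in> {0..1} \<Longrightarrow> k (t, sphere_base \<kappa> ?n) = z0"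
    unfolding homotopic_with_def by blast
  \<comment> \<open>In \<open>homotopic_with\<close> time is the first component, in
    \<open>image_relative_homotopic\<close> the second; hence the swap.\<close>
  define H where "H = \<phi> \<circ> k \<circ> prod.swap"
  have "\<phi> ` topspace Z = f ` topspace (cube p) \<union> g ` topspace (cube q) \<union> h ` topspace (cube r)"
  proof -
    have "{..<3} = {0, 1, 2 :: nat}"
      by auto
    then show ?thesis
      using fgh by (auto simp: topZ m_def image_Un image_image)
  qed
  \<comment> \<open>The Jacobi sum already fills the whole image of \<open>\<phi>\<close>, so a
    homotopy through \<open>\<phi>\<close> cannot leave its image.\<close>
  then have im: "\<phi> ` topspace Z = ?J ` topspace ?S"
    unfolding sphere_map_image [OF ident n J(1)] J(2) .
  \<comment> \<open>The image of the constant map adds nothing to the union, since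
    \<open>x0 = \<phi> z0\<close> is already a value of the Jacobi sum.\<close>
  have base: "x0 \<in> ?J ` topspace ?S"
    using imageI [OF Z(2), of \<phi>] by (simp only: im \<phi>(2))
  \<comment> \<open>Naturality, applied at the chosen preimage of \<open>y\<close> in the cube,
    identifies the start of the pushed homotopy with the given sum.\<close>
  have H0: "H (y, 0) = ?J y" if "y \<in> topspace ?S" for y
    using jacobi_sum_cong [OF ident pqr inv_kappa(1) [OF ident n that],
        of f \<phi> "a 0" g "a 1" h "a 2"] fgh
    by (simp add: H_def k(2) sphere_map_def)
  have "k ` ({0..1} \<times> topspace ?S) \<subseteq> topspace Z"
    using continuous_map_image_subset_topspace [OF k(1)] by simp
  then have "H ` (topspace ?S \<times> {0..1}) \<subseteq> \<phi> ` topspace Z"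
    by (auto simp: H_def image_subset_iff intro!: imageI)
  \<comment> \<open>The reverse inclusion is witnessed at time 0.\<close>
  moreover have "?J ` topspace ?S \<subseteq> H ` (topspace ?S \<times> {0..1})"
  proof (rule image_subsetI)
    fix y
    assume "y \<in> topspace ?S"
    then show "?J y \<in> H ` (topspace ?S \<times> {0..1})"
      using H0 by (intro image_eqI [where x = "(y, 0)"]) auto
  qed
  ultimately have "H ` (topspace ?S \<times> {0..1}) = ?J ` topspace ?S \<union> (\<lambda>_. x0) ` topspace ?S"
    using im base by blast
  moreover have "continuous_map (prod_topology ?S (top_of_set {0..1::real})) X H"
    unfolding H_def
    by (rule continuous_map_compose [OF _ continuous_map_compose [OF k(1) \<phi>(1)]])
      (simp add: prod.swap_def continuous_map_pairwise o_def continuous_map_fst continuous_map_snd)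
  ultimately show "image_relative_homotopic ?S (sphere_base \<kappa> ?n) X x0 ?J (\<lambda>_. x0)"
    unfolding image_relative_homotopic_def
    using H0 k(3,4) \<phi>(2) by (intro exI [of _ H]) (auto simp: H_def)
qed

end
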